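(* Let $Q:C_+\to C_+$ satisfy (A1)–(A4), with associated limit maps $Q_\pm$ and $r^*\in\mathrm{Int}(Y_+)$. Assume that $Q_+$ satisfies (AA) with constants $\bar c_-,\bar c_+$ and that $Q_-$ satisfies (UAA). Then the following statements are valid. (i) If $\varphi\in C_{r^*}$ has compact support, then for all $\varepsilon>0$, $$\lim_{n\to\infty}\Big[\sup\{Q^n[\varphi](\theta,x):(\theta,x)\in M\times n(\mathbb R\setminus[-\bar c_--\varepsilon,\bar c_++\varepsilon])\}\Big]=0.$$ (ii) If $Q[r^{**}]\le r^{**}$ for some $r^{**}\in\mathrm{Int}(Y_+)$, then $$\lim_{n\to\infty}\Big[\sup\{\|Q^n[\varphi](\cdot,x)\|_Y:x\in(-\infty,-n\varepsilon]\}\Big]=0$$ for all $\varepsilon>0$ and $\varphi\in C_{r^{**}}$. In particular, this limit is $0$ for all $\varepsilon>0$ and $\varphi\in C_{r^*}$.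
   Context: Spaces. Fix $N\ge1$ and a compact topological space $M$. $X$ is the space of bounded continuous functions $\mathbb R\to\mathbb R^N$ with norm $\|\phi\|_X=\sum_{n\ge1}2^{-n}\sup_{|x|\le n}\|\phi(x)\|_{\mathbb R^N}$. $C=C(M,X)$ with norm $\sup_{\theta\in M}\|\varphi(\theta)\|_X$; elements of $C$ are identified with bounded continuous functions $\varphi(\theta,x)$ from $M\times\mathbb R$ to $\mathbb R^N$. $C_+=\{\varphi\in C:\varphi(\theta,x)\in\mathbb R_+^N\ \forall(\theta,x)\}$. $Y=C(M,\mathbb R^N)$ with sup norm, $Y_+=C(M,\mathbb R^N_+)$, $\mathrm{Int}(Y_+)=\{\beta\in Y:\beta(\theta)\in \mathrm{Int}(\mathbb R^N_+)\ \forall\theta\}$. Vectors of $\mathbb R^N$ and elements of $Y$ are identified with the elements of $C$ that are constant in the remaining variables. Order relations $\le$ and suprema of $\mathbb R^N$-valued quantities are pointwise and componentwise. For $\psi\in C_+$, $C_\psi=[0,\psi]_C=\{\varphi\in C:0\le\varphi\le\psi\}$. $T_y[\varphi](\theta,x)=\varphi(\theta,x-y)$ for $y\in\mathbb R$. For $A\subseteq\mathbb R$, $nA=\{na:a\in A\}$. Standing assumptions on a map $Q:C_+\to C_+$: (A1) $T_{-y}\circ Q[\varphi]\ge Q\circ T_{-y}[\varphi]$ for all $\varphi\in C_+$, $y\ge0$. (A2) For every vector $r\in\mathrm{Int}(\mathbb R_+^N)$, $Q|_{C_r}:C_r\to C_+$ is continuous, and monotone: $Q[\phi]\le Q[\psi]$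 whenever $\phi\le\psi$ in $C_r$. By (A1), $T_{-y}\circ Q\circ T_y[\varphi](\theta,x)$ is nondecreasing in $y$; define $Q_\pm:C_+\to L^\infty(M\times\mathbb R,\mathbb R^N)$ by $Q_\pm[\varphi](\theta,x)=\lim_{y\to\pm\infty}T_{-y}\circ Q\circ T_y[\varphi](\theta,x)$. (A3) For all $\varphi\in C_+$, $n\in\mathbb N$: $T_{-y}\circ Q^n\circ T_y[\varphi]\to Q_\pm^n[\varphi]$ in $C$ as $y\to\pm\infty$. (A4) For every vector $r\in\mathrm{Int}(\mathbb R^N_+)$, $Q_\pm|_{C_r}:C_r\to C_+$ is continuous, $Q_+[0]=0$, and $Q_+[r^*]=r^*$ for some $r^*\in\mathrm{Int}(Y_+)$ (fixed). Properties: (AA) There are $\bar c_-,\bar c_+\in\mathbb R$ with $\bar c_++\bar c_->0$ and $\lim_{n\to\infty}\sup_{x\notin n[-\bar c_--\varepsilon,\bar c_++\varepsilon]}\|Q_+^n[\varphi](\cdot,x)\|_Y=0$ for all $\varepsilon>0$ and all $\varphi\in C_{r^*}$ having compact support. (UAA) $\lim_{n\to\infty}\sup_{(\theta,x)\in M\times\mathbb R}Q_-^n[\varphi](\theta,x)=0$ for all $\varphi\in C_+$. *)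

theory Defs
  imports "HOL-Analysis.Analysis"
begin

text \<open>
  The compact space is the type \<open>'m\<close> (compactness is assumed where needed), and \<open>R^N\<close> is
  \<open>real ^ 'n\<close>, whose library order and \<open>Sup\<close> are componentwise; functions are ordered pointwise.
  Operators such as \<open>Q\<close> are HOL functions on all of \<open>'m \<Rightarrow> real \<Rightarrow> real ^ 'n\<close>, of which only the
  values on \<open>C_plus\<close> matter.
\<close>

section \<open>Spaces\<close>

definition orthant :: "(real ^ 'n) set" where
  "orthant = {v. 0 \<le> v}"

definition C_space :: "('m::topological_space \<Rightarrow> real \<Rightarrow> real ^ 'n) set" where
  "C_space = {\<phi>. continuous_on UNIV (\<lambda>(\<theta>, x). \<phi> \<theta> x) \<and> bounded (range (\<lambda>(\<theta>, x). \<phi> \<theta> x))}"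

definition C_plus :: "('m::topological_space \<Rightarrow> real \<Rightarrow> real ^ 'n) set" where
  "C_plus = {\<phi> \<in> C_space. \<forall>\<theta> x. \<phi> \<theta> x \<in> orthant}"

definition C_int ::
  "('m::topological_space \<Rightarrow> real \<Rightarrow> real ^ 'n) \<Rightarrow> ('m \<Rightarrow> real \<Rightarrow> real ^ 'n) set" where
  "C_int \<psi> = {\<phi> \<in> C_space. (\<lambda>\<theta> x. 0) \<le> \<phi> \<and> \<phi> \<le> \<psi>}"

definition const_fun :: "real ^ 'n \<Rightarrow> 'm \<Rightarrow> real \<Rightarrow> real ^ 'n" where
  "const_fun r = (\<lambda>\<theta> x. r)"

definition lift_Y :: "('m \<Rightarrow> real ^ 'n) \<Rightarrow> 'm \<Rightarrow> real \<Rightarrow> real ^ 'n" where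
  "lift_Y \<beta> = (\<lambda>\<theta> x. \<beta> \<theta>)"

definition Int_Y_plus :: "('m::topological_space \<Rightarrow> real ^ 'n) set" where
  "Int_Y_plus = {\<beta>. continuous_on UNIV \<beta> \<and> (\<forall>\<theta>. \<beta> \<theta> \<in> interior orthant)}"

definition norm_Y :: "('m \<Rightarrow> real ^ 'n) \<Rightarrow> real" where
  "norm_Y \<beta> = (SUP \<theta>. norm (\<beta> \<theta>))"

text \<open>The sum over \<open>n \<ge> 1\<close> is indexed by \<open>Suc k\<close>.\<close>

definition norm_X :: "(real \<Rightarrow> real ^ 'n) \<Rightarrow> real" where
  "norm_X f = (\<Sum>k. (1 / 2) ^ Suc k * (SUP x\<in>{x. \<bar>x\<bar> \<le> real (Suc k)}. norm (f x)))"

definition norm_C :: "('m \<Rightarrow> real \<Rightarrow> real ^ 'n) \<Rightarrow> real" where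
  "norm_C \<phi> = (SUP \<theta>. norm_X (\<phi> \<theta>))"

text \<open>
  The value \<open>0\<close> outside \<open>C_space\<close> is irrelevant for the topology; it is there because
  \<open>Metric_space\<close> requires nonnegativity and symmetry on the whole type.
\<close>

definition dist_C ::
  "('m::topological_space \<Rightarrow> real \<Rightarrow> real ^ 'n) \<Rightarrow> ('m \<Rightarrow> real \<Rightarrow> real ^ 'n) \<Rightarrow> real" where
  "dist_C \<phi> \<psi> =
     (if \<phi> \<in> C_space \<and> \<psi> \<in> C_space then norm_C (\<lambda>\<theta> x. \<phi> \<theta> x - \<psi> \<theta> x) else 0)"

definition top_C :: "('m::topological_space \<Rightarrow> real \<Rightarrow> real ^ 'n) topology" where
  "top_C = Metric_space.mtopology C_space dist_C"

definition compact_support :: "('m::topological_space \<Rightarrow> real \<Rightarrow> real ^ 'n) \<Rightarrow> bool" where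
  "compact_support \<phi> \<longleftrightarrow> compact (closure {(\<theta>, x). \<phi> \<theta> x \<noteq> 0})"

section \<open>Standing assumptions\<close>

definition transl :: "real \<Rightarrow> ('m \<Rightarrow> real \<Rightarrow> real ^ 'n) \<Rightarrow> 'm \<Rightarrow> real \<Rightarrow> real ^ 'n" where
  "transl y \<phi> = (\<lambda>\<theta> x. \<phi> \<theta> (x - y))"

definition Q_plus ::
  "(('m \<Rightarrow> real \<Rightarrow> real ^ 'n) \<Rightarrow> ('m \<Rightarrow> real \<Rightarrow> real ^ 'n)) \<Rightarrow>
   ('m \<Rightarrow> real \<Rightarrow> real ^ 'n) \<Rightarrow> ('m \<Rightarrow> real \<Rightarrow> real ^ 'n)" where
  "Q_plus Q \<phi> = (\<lambda>\<theta> x. Lim at_top (\<lambda>y. transl (- y) (Q (transl y \<phi>)) \<theta> x))"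

definition Q_minus ::
  "(('m \<Rightarrow> real \<Rightarrow> real ^ 'n) \<Rightarrow> ('m \<Rightarrow> real \<Rightarrow> real ^ 'n)) \<Rightarrow>
   ('m \<Rightarrow> real \<Rightarrow> real ^ 'n) \<Rightarrow> ('m \<Rightarrow> real \<Rightarrow> real ^ 'n)" where
  "Q_minus Q \<phi> = (\<lambda>\<theta> x. Lim at_bot (\<lambda>y. transl (- y) (Q (transl y \<phi>)) \<theta> x))"

definition A1 ::
  "(('m::topological_space \<Rightarrow> real \<Rightarrow> real ^ 'n) \<Rightarrow> ('m \<Rightarrow> real \<Rightarrow> real ^ 'n)) \<Rightarrow> bool" where
  "A1 Q \<longleftrightarrow> (\<forall>\<phi>\<in>C_plus. \<forall>y\<ge>0. Q (transl (- y) \<phi>) \<le> transl (- y) (Q \<phi>))"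

definition A2 ::
  "(('m::topological_space \<Rightarrow> real \<Rightarrow> real ^ 'n) \<Rightarrow> ('m \<Rightarrow> real \<Rightarrow> real ^ 'n)) \<Rightarrow> bool" where
  "A2 Q \<longleftrightarrow> (\<forall>r\<in>interior orthant.
     continuous_map (subtopology top_C (C_int (const_fun r))) (subtopology top_C C_plus) Q \<and>
     (\<forall>\<phi>\<in>C_int (const_fun r). \<forall>\<psi>\<in>C_int (const_fun r). \<phi> \<le> \<psi> \<longrightarrow> Q \<phi> \<le> Q \<psi>))"

text \<open>
  For \<open>n = 1\<close>, \<open>A3\<close> makes the limits in \<open>Q_plus\<close> and \<open>Q_minus\<close> exist pointwise on \<open>C_plus\<close> and
  these maps send \<open>C_plus\<close> into itself, so that their iterates make sense.
\<close>

definition A3 ::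
  "(('m::topological_space \<Rightarrow> real \<Rightarrow> real ^ 'n) \<Rightarrow> ('m \<Rightarrow> real \<Rightarrow> real ^ 'n)) \<Rightarrow> bool" where
  "A3 Q \<longleftrightarrow> (\<forall>\<phi>\<in>C_plus. \<forall>n.
     limitin top_C (\<lambda>y. transl (- y) ((Q ^^ n) (transl y \<phi>))) ((Q_plus Q ^^ n) \<phi>) at_top \<and>
     limitin top_C (\<lambda>y. transl (- y) ((Q ^^ n) (transl y \<phi>))) ((Q_minus Q ^^ n) \<phi>) at_bot)"

definition A4 ::
  "(('m::topological_space \<Rightarrow> real \<Rightarrow> real ^ 'n) \<Rightarrow> ('m \<Rightarrow> real \<Rightarrow> real ^ 'n)) \<Rightarrow>
   ('m \<Rightarrow> real ^ 'n) \<Rightarrow> bool" where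
  "A4 Q rs \<longleftrightarrow>
     (\<forall>r\<in>interior orthant.
        continuous_map (subtopology top_C (C_int (const_fun r))) (subtopology top_C C_plus)
          (Q_plus Q) \<and>
        continuous_map (subtopology top_C (C_int (const_fun r))) (subtopology top_C C_plus)
          (Q_minus Q)) \<and>
     Q_plus Q (\<lambda>\<theta> x. 0) = (\<lambda>\<theta> x. 0) \<and>
     rs \<in> Int_Y_plus \<and> Q_plus Q (lift_Y rs) = lift_Y rs"

section \<open>Asymptotic annihilation\<close>

text \<open>In the next two definitions, \<open>P\<close> stands for \<open>Q_plus Q\<close> and \<open>Q_minus Q\<close>, respectively.\<close>

definition AA ::
  "(('m::topological_space \<Rightarrow> real \<Rightarrow> real ^ 'n) \<Rightarrow> ('m \<Rightarrow> real \<Rightarrow> real ^ 'n)) \<Rightarrow>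
   ('m \<Rightarrow> real ^ 'n) \<Rightarrow> real \<Rightarrow> real \<Rightarrow> bool" where
  "AA P rs cminus cplus \<longleftrightarrow>
     cplus + cminus > 0 \<and>
     (\<forall>\<epsilon>>0. \<forall>\<phi>\<in>C_int (lift_Y rs). compact_support \<phi> \<longrightarrow>
        (\<lambda>n. SUP x\<in>- ((*) (real n) ` {- cminus - \<epsilon>..cplus + \<epsilon>}).
               norm_Y (\<lambda>\<theta>. (P ^^ n) \<phi> \<theta> x)) \<longlonglongrightarrow> 0)"

definition UAA ::
  "(('m::topological_space \<Rightarrow> real \<Rightarrow> real ^ 'n) \<Rightarrow> ('m \<Rightarrow> real \<Rightarrow> real ^ 'n)) \<Rightarrow> bool" where
  "UAA P \<longleftrightarrow> (\<forall>\<phi>\<in>C_plus. (\<lambda>n. SUP (\<theta>, x)\<in>UNIV. (P ^^ n) \<phi> \<theta> x) \<longlonglongrightarrow> 0)"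

section \<open>Basic facts\<close>

lemma interior_orthant: "interior (orthant :: (real ^ 'n) set) = {v. \<forall>i. 0 < v $ i}"
proof
  have "interior (orthant :: (real ^ 'n) set) \<subseteq> interior {v. v $ i \<ge> 0}" for i
    by (rule interior_mono) (auto simp: orthant_def less_eq_vec_def)
  then show "interior (orthant :: (real ^ 'n) set) \<subseteq> {v. \<forall>i. 0 < v $ i}"
    by auto
  have "open (\<Inter>i. {v :: real ^ 'n. 0 < v $ i})"
    by (intro open_INT) (auto intro!: open_Collect_less continuous_intros)
  also have "(\<Inter>i. {v :: real ^ 'n. 0 < v $ i}) = {v. \<forall>i. 0 < v $ i}"
    by auto
  finally show "{v :: real ^ 'n. \<forall>i. 0 < v $ i} \<subseteq> interior orthant"
    by (intro interior_maximal) (auto simp: orthant_def less_eq_vec_def less_imp_le)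
qed

context
  fixes f :: "real \<Rightarrow> real ^ 'n" and B :: real
  assumes B: "\<And>x. norm (f x) \<le> B"
begin

lemma norm_X_bdd: "bdd_above ((\<lambda>x. norm (f x)) ` S)"
  using B by (auto intro!: bdd_aboveI)

lemma norm_X_le_sup: "\<bar>x\<bar> \<le> real (Suc k) \<Longrightarrow>
    norm (f x) \<le> (SUP x\<in>{x. \<bar>x\<bar> \<le> real (Suc k)}. norm (f x))"
  by (rule cSUP_upper[OF _ norm_X_bdd]) auto

lemma norm_X_sup_nonneg: "0 \<le> (SUP x\<in>{x. \<bar>x\<bar> \<le> real (Suc k)}. norm (f x))"
  using norm_X_le_sup[of 0 k] norm_ge_zero[of "f 0"] by (simp del: norm_ge_zero)

lemma norm_X_sup_le: "(SUP x\<in>{x. \<bar>x\<bar> \<le> real (Suc k)}. norm (f x)) \<le> B"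
  by (rule cSUP_least) (auto simp: B intro!: exI[of _ 0])

lemma norm_X_summable:
  "summable (\<lambda>k. (1 / 2) ^ Suc k * (SUP x\<in>{x. \<bar>x\<bar> \<le> real (Suc k)}. norm (f x)))"
proof (rule summable_comparison_test)
  show "summable (\<lambda>k. (1 / 2) ^ Suc k * B)"
    by (intro summable_mult2 summable_ignore_initial_segment[of _ 1, simplified] summable_geometric)
      auto
  have "norm ((1 / 2) ^ Suc k * (SUP x\<in>{x. \<bar>x\<bar> \<le> real (Suc k)}. norm (f x))) \<le> (1 / 2) ^ Suc k * B"
    for k
    using norm_X_sup_nonneg[of k] norm_X_sup_le[of k]
    by (simp add: abs_mult)
  then show "\<exists>N. \<forall>k\<ge>N. norm ((1 / 2) ^ Suc k * (SUP x\<in>{x. \<bar>x\<bar> \<le> real (Suc k)}. norm (f x)))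
      \<le> (1 / 2) ^ Suc k * B"
    by blast
qed

lemma norm_X_nonneg: "0 \<le> norm_X f"
  unfolding norm_X_def
  by (intro suminf_nonneg norm_X_summable mult_nonneg_nonneg norm_X_sup_nonneg) auto

lemma norm_X_le: "norm_X f \<le> B"
proof -
  have "norm_X f \<le> (\<Sum>k. (1 / 2) ^ Suc k * B)"
    unfolding norm_X_def
    by (intro suminf_le norm_X_summable summable_mult2 mult_left_mono norm_X_sup_le
        summable_ignore_initial_segment[of _ 1, simplified] summable_geometric) auto
  also have "\<dots> = B"
    using sums_mult2[OF power_half_series, of B] by (simp add: sums_iff)
  finally show ?thesis .
qed

lemma norm_X_pos: "f x \<noteq> 0 \<Longrightarrow> 0 < norm_X f"
proof -
  assume nz: "f x \<noteq> 0"
  obtain n where "\<bar>x\<bar> \<le> real n"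
    using real_arch_simple by blast
  then obtain k where k: "\<bar>x\<bar> \<le> real (Suc k)"
    using that[of n] by simp
  have "0 < (SUP x\<in>{x. \<bar>x\<bar> \<le> real (Suc k)}. norm (f x))"
    using norm_X_le_sup[OF k] nz zero_less_norm_iff[of "f x"]
    by linarith
  then have "0 < (1 / 2) ^ Suc k * (SUP x\<in>{x. \<bar>x\<bar> \<le> real (Suc k)}. norm (f x))"
    by simp
  then show ?thesis
    unfolding norm_X_def
    using suminf_pos2[OF norm_X_summable, of k] norm_X_sup_nonneg by simp
qed

end

lemma norm_X_triangle:
  fixes f g :: "real \<Rightarrow> real ^ 'n"
  assumes f: "\<And>x. norm (f x) \<le> A" and g: "\<And>x. norm (g x) \<le> B"
  shows "norm_X (\<lambda>x. f x + g x) \<le> norm_X f + norm_X g"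
proof -
  have fg: "norm (f x + g x) \<le> A + B" for x
    using norm_triangle_mono[OF f g] .
  have sup: "(SUP x\<in>{x. \<bar>x\<bar> \<le> real (Suc k)}. norm (f x + g x))
     \<le> (SUP x\<in>{x. \<bar>x\<bar> \<le> real (Suc k)}. norm (f x))
       + (SUP x\<in>{x. \<bar>x\<bar> \<le> real (Suc k)}. norm (g x))" for k
    by (rule cSUP_least)
      (auto intro!: exI[of _ 0] norm_triangle_mono norm_X_le_sup[OF f] norm_X_le_sup[OF g]
        simp del: of_nat_Suc)
  show ?thesis
    unfolding norm_X_def suminf_add[OF norm_X_summable[OF f] norm_X_summable[OF g]]
      distrib_left[symmetric]
    using norm_X_summable[OF fg] summable_add[OF norm_X_summable[OF f] norm_X_summable[OF g]] sup
    by (intro suminf_le mult_left_mono) (auto simp: distrib_left)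
qed

lemma C_space_diff_bound:
  assumes "\<phi> \<in> C_space" "\<psi> \<in> C_space"
  obtains B where "\<And>\<theta> x. norm (\<phi> \<theta> x - \<psi> \<theta> x) \<le> B"
proof -
  obtain b where b: "\<And>\<theta> x. norm (\<phi> \<theta> x) \<le> b"
    using assms(1) by (force simp: C_space_def bounded_iff)
  obtain c where c: "\<And>\<theta> x. norm (\<psi> \<theta> x) \<le> c"
    using assms(2) by (force simp: C_space_def bounded_iff)
  show thesis
    by (rule that[of "b + c"]) (meson add_mono b c norm_triangle_ineq4 order_trans)
qed

lemma norm_X_le_norm_C:
  assumes "\<And>\<theta> x. norm (\<phi> \<theta> x) \<le> B"
  shows "norm_X (\<phi> \<theta>) \<le> norm_C \<phi>"
  unfolding norm_C_def
  by (rule cSUP_upper) (auto intro!: bdd_aboveI[of _ B] norm_X_le assms)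

interpretation C_metric: Metric_space C_space dist_C
proof
  show "0 \<le> dist_C \<phi> \<psi>" for \<phi> \<psi> :: "'a \<Rightarrow> real \<Rightarrow> real ^ 'b"
  proof (cases "\<phi> \<in> C_space \<and> \<psi> \<in> C_space")
    case True
    then obtain B where B: "\<And>\<theta> x. norm (\<phi> \<theta> x - \<psi> \<theta> x) \<le> B"
      using C_space_diff_bound by blast
    have "0 \<le> norm_X (\<lambda>x. \<phi> undefined x - \<psi> undefined x)"
      by (rule norm_X_nonneg[OF B])
    also have "\<dots> \<le> norm_C (\<lambda>\<theta> x. \<phi> \<theta> x - \<psi> \<theta> x)"
      using norm_X_le_norm_C[OF B] .
    finally show ?thesis using True by (simp add: dist_C_def)
  qed (auto simp: dist_C_def)
  show "dist_C \<phi> \<psi> = dist_C \<psi> \<phi>" for \<phi> \<psi> :: "'a \<Rightarrow> real \<Rightarrow> real ^ 'b"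
    by (auto simp: dist_C_def norm_C_def norm_X_def norm_minus_commute)
next
  fix \<phi> \<psi> :: "'a \<Rightarrow> real \<Rightarrow> real ^ 'b"
  assume C: "\<phi> \<in> C_space" "\<psi> \<in> C_space"
  then obtain B where B: "\<And>\<theta> x. norm (\<phi> \<theta> x - \<psi> \<theta> x) \<le> B"
    using C_space_diff_bound by blast
  show "dist_C \<phi> \<psi> = 0 \<longleftrightarrow> \<phi> = \<psi>"
  proof
    assume "dist_C \<phi> \<psi> = 0"
    then have "norm_X (\<lambda>x. \<phi> \<theta> x - \<psi> \<theta> x) \<le> 0" for \<theta>
      using norm_X_le_norm_C[of "\<lambda>\<theta> x. \<phi> \<theta> x - \<psi> \<theta> x", OF B, of \<theta>] C
      by (simp add: dist_C_def)
    then have "\<phi> \<theta> x - \<psi> \<theta> x = 0" for \<theta> x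
      using norm_X_pos[of "\<lambda>x. \<phi> \<theta> x - \<psi> \<theta> x", OF B, of x]
      by (meson not_less)
    then show "\<phi> = \<psi>" by (auto simp: fun_eq_iff)
  next
    have "{x. \<bar>x\<bar> \<le> 1 + real k} \<noteq> {}" for k
      by (auto intro!: exI[of _ 0])
    then show "dist_C \<phi> \<psi> = 0" if "\<phi> = \<psi>"
      using that by (simp add: dist_C_def norm_C_def norm_X_def)
  qed
next
  fix \<phi> \<psi> \<eta> :: "'a \<Rightarrow> real \<Rightarrow> real ^ 'b"
  assume C: "\<phi> \<in> C_space" "\<psi> \<in> C_space" "\<eta> \<in> C_space"
  obtain A where A: "\<And>\<theta> x. norm (\<phi> \<theta> x - \<psi> \<theta> x) \<le> A"
    using C_space_diff_bound C by blast
  obtain B where B: "\<And>\<theta> x. norm (\<psi> \<theta> x - \<eta> \<theta> x) \<le> B"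
    using C_space_diff_bound C by blast
  have "norm_X (\<lambda>x. \<phi> \<theta> x - \<eta> \<theta> x)
      \<le> norm_C (\<lambda>\<theta> x. \<phi> \<theta> x - \<psi> \<theta> x) + norm_C (\<lambda>\<theta> x. \<psi> \<theta> x - \<eta> \<theta> x)" for \<theta>
    using norm_X_triangle[of "\<lambda>x. \<phi> \<theta> x - \<psi> \<theta> x" _ "\<lambda>x. \<psi> \<theta> x - \<eta> \<theta> x",
        OF A[of \<theta>] B[of \<theta>]]
      norm_X_le_norm_C[of "\<lambda>\<theta> x. \<phi> \<theta> x - \<psi> \<theta> x", OF A, of \<theta>]
      norm_X_le_norm_C[of "\<lambda>\<theta> x. \<psi> \<theta> x - \<eta> \<theta> x", OF B, of \<theta>]
    by simp
  then show "dist_C \<phi> \<eta> \<le> dist_C \<phi> \<psi> + dist_C \<psi> \<eta>"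
    using C by (simp add: dist_C_def norm_C_def[of "\<lambda>\<theta> x. \<phi> \<theta> x - \<eta> \<theta> x"] cSUP_least)
qed

lemma Metric_space_C: "Metric_space C_space dist_C"
  by (rule C_metric.Metric_space_axioms)

end

theory Submission
  imports Defs
begin

text \<open>
  Everything rests on comparing the nonlinear iteration with its two limits. By \<open>A1\<close> the conjugates
  \<open>transl (- y) \<circ> Q \<circ> transl y\<close> increase with \<open>y\<close>, so \<open>Q \<phi> \<le> Q_plus Q \<phi>\<close>
  (\<open>Q_le_Q_plus\<close>), and monotonicity of \<open>Q\<close> carries this to all iterates
  (\<open>Q_iter_le_Q_plus_iter\<close>). The first statement is then inherited from the annihilation
  property \<open>AA\<close> of \<open>Q_plus Q\<close>.

  For the second, monotonicity reduces the claim to the orbit \<open>w n\<close> of the upper solution \<open>r\<close>,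
  that is, \<open>w n = (Q ^^ n) r\<close>. It decreases in \<open>n\<close> because \<open>Q r \<le> r\<close>, and it is nondecreasing in
  \<open>x\<close> because \<open>A1\<close> propagates spatial monotonicity (\<open>Q_iter_mono_space\<close>). Hence a single value
  \<open>w k \<theta> (- L)\<close> bounds \<open>w n \<theta> x\<close> for all \<open>n \<ge> k\<close> and \<open>x \<le> - L\<close>, and eventually the whole
  half-line up to \<open>- (n * \<epsilon>)\<close> lies in this range. This value is small for suitable \<open>k\<close> and \<open>L\<close>: as
  \<open>L\<close> grows, it approaches \<open>(Q_minus Q ^^ k) r\<close> by \<open>A3\<close>, uniformly in \<open>\<theta>\<close>, and that limit vanishes
  as \<open>k\<close> grows by \<open>UAA\<close>. Finally, the fixed point of \<open>Q_plus Q\<close> is itself an upper solution of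
  \<open>Q\<close>, by \<open>Q_le_Q_plus\<close>.
\<close>

section \<open>Order and norm on function spaces\<close>

lemma norm_mono_vec:
  fixes v w :: "real ^ 'n"
  assumes "0 \<le> v" "v \<le> w"
  shows "norm v \<le> norm w"
  unfolding norm_vec_def
  using assms by (intro L2_set_mono) (auto simp: less_eq_vec_def intro: order_trans)

lemma C_plus_iff: "\<phi> \<in> C_plus \<longleftrightarrow> \<phi> \<in> C_space \<and> (\<forall>\<theta> x. 0 \<le> \<phi> \<theta> x)"
  by (simp add: C_plus_def orthant_def)

lemma C_space_norm_bound:
  assumes "\<phi> \<in> C_space"
  obtains B where "\<And>\<theta> x. norm (\<phi> \<theta> x) \<le> B"
  using assms by (force simp: C_space_def bounded_iff)

lemma C_int_subset_C_plus: "C_int \<psi> \<subseteq> C_plus"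
  by (auto simp: C_int_def C_plus_iff le_fun_def)

lemma transl_in_C_plus:
  assumes "\<phi> \<in> C_plus"
  shows "transl y \<phi> \<in> C_plus"
proof -
  have c: "continuous_on UNIV (\<lambda>(\<theta>, x). \<phi> \<theta> x)"
    using assms by (simp add: C_plus_iff C_space_def)
  have "continuous_on UNIV (\<lambda>p. (\<lambda>(\<theta>, x). \<phi> \<theta> x) (fst p, snd p - y))"
    by (rule continuous_on_compose2[OF c]) (auto intro!: continuous_intros)
  moreover obtain B where "\<And>\<theta> x. norm (\<phi> \<theta> x) \<le> B"
    using assms C_space_norm_bound by (auto simp: C_plus_iff)
  ultimately show ?thesis
    using assms by (auto simp: C_plus_iff C_space_def transl_def case_prod_unfold bounded_iff)
qed

text \<open>Compactness of the parameter space is what makes continuous profiles bounded.\<close>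

lemma lift_Y_in_C_plus:
  fixes \<beta> :: "'m::topological_space \<Rightarrow> real ^ 'n"
  assumes "compact (UNIV :: 'm set)" "\<beta> \<in> Int_Y_plus"
  shows "lift_Y \<beta> \<in> C_plus"
proof -
  have c: "continuous_on UNIV \<beta>" and p: "\<And>\<theta>. \<beta> \<theta> \<in> interior orthant"
    using assms(2) by (auto simp: Int_Y_plus_def)
  have "bounded (range \<beta>)"
    using compact_continuous_image[OF c assms(1)] by (rule compact_imp_bounded)
  then obtain B where "\<And>\<theta>. norm (\<beta> \<theta>) \<le> B"
    by (auto simp: bounded_iff)
  moreover have "continuous_on UNIV (\<lambda>p :: 'm \<times> real. \<beta> (fst p))"
    by (rule continuous_on_compose2[OF c]) (auto intro!: continuous_intros)
  moreover have "0 \<le> \<beta> \<theta>" for \<theta>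
    using p[of \<theta>] interior_subset by (force simp: orthant_def)
  ultimately show ?thesis
    by (auto simp: C_plus_iff C_space_def lift_Y_def case_prod_unfold bounded_iff)
qed

section \<open>Convergence in the weighted norm\<close>

text \<open>
  Evaluation at a fixed point is bounded by any one term of the series that reaches it.
\<close>

lemma norm_le_norm_X:
  fixes f :: "real \<Rightarrow> real ^ 'n"
  assumes B: "\<And>x. norm (f x) \<le> B" and x: "\<bar>x\<bar> \<le> real (Suc k)"
  shows "norm (f x) \<le> 2 ^ Suc k * norm_X f"
proof -
  let ?s = "\<lambda>k. (SUP x\<in>{x. \<bar>x\<bar> \<le> real (Suc k)}. norm (f x))"
  have "(1 / 2) ^ Suc k * norm (f x) \<le> (1 / 2) ^ Suc k * ?s k"
    using norm_X_le_sup[of f, OF B x] by (intro mult_left_mono) auto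
  also have "\<dots> = (\<Sum>j\<in>{k}. (1 / 2) ^ Suc j * ?s j)"
    by simp
  also have "\<dots> \<le> norm_X f"
    unfolding norm_X_def
    by (rule sum_le_suminf[OF norm_X_summable[of f, OF B]])
      (auto intro!: mult_nonneg_nonneg norm_X_sup_nonneg[of f, OF B] simp del: of_nat_Suc)
  finally show ?thesis
    by (simp add: field_simps)
qed

text \<open>
  The norm of \<open>C\<close> weighs \<open>x\<close> but not \<open>\<theta>\<close>, so convergence is uniform in \<open>\<theta>\<close> at each \<open>x\<close>.
\<close>

lemma limitin_top_C_uniform:
  fixes l :: "'m::topological_space \<Rightarrow> real \<Rightarrow> real ^ 'n"
  assumes lim: "limitin top_C f l F" and e: "e > 0"
  shows "\<forall>\<^sub>F y in F. \<forall>\<theta>. norm (f y \<theta> x - l \<theta> x) < e"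
proof -
  obtain n where "\<bar>x\<bar> \<le> real n"
    using real_arch_simple by blast
  then obtain k where k: "\<bar>x\<bar> \<le> real (Suc k)"
    using that[of n] by simp
  have l: "l \<in> C_space"
    and ev: "\<forall>\<^sub>F y in F. f y \<in> C_space \<and> dist_C (f y) l < e / 2 ^ Suc k"
    using lim e Metric_space.limitin_metric[OF Metric_space_C, of f l F]
    by (auto simp: top_C_def)
  from ev show ?thesis
  proof (rule eventually_mono, intro allI)
    fix y \<theta>
    assume y: "f y \<in> C_space \<and> dist_C (f y) l < e / 2 ^ Suc k"
    obtain B where B: "\<And>\<theta> x. norm (f y \<theta> x - l \<theta> x) \<le> B"
      using C_space_diff_bound y l by blast
    have "norm (f y \<theta> x - l \<theta> x) \<le> 2 ^ Suc k * norm_X (\<lambda>x. f y \<theta> x - l \<theta> x)"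
      by (rule norm_le_norm_X[OF B k])
    also have "\<dots> \<le> 2 ^ Suc k * dist_C (f y) l"
      using norm_X_le_norm_C[of "\<lambda>\<theta> x. f y \<theta> x - l \<theta> x", OF B, of \<theta>] y l
      by (simp add: dist_C_def)
    also have "\<dots> < e"
      using y by (simp add: field_simps)
    finally show "norm (f y \<theta> x - l \<theta> x) < e" .
  qed
qed

lemma limitin_top_C_pointwise:
  assumes "limitin top_C f l F"
  shows "((\<lambda>y. f y \<theta> x) \<longlongrightarrow> l \<theta> x) F"
  unfolding tendsto_iff dist_norm
  by (intro allI impI eventually_mono[OF limitin_top_C_uniform[OF assms]]) auto

lemma tendsto_lowerbound_vec:
  fixes l :: "real ^ 'n"
  assumes "(f \<longlongrightarrow> l) F" "\<forall>\<^sub>F y in F. a \<le> f y" "F \<noteq> bot"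
  shows "a \<le> l"
  unfolding less_eq_vec_def
proof
  fix i
  show "a $ i \<le> l $ i"
    using assms(2) by (intro tendsto_lowerbound[OF tendsto_vec_nth[OF assms(1)] _ assms(3)])
      (auto elim!: eventually_mono simp: less_eq_vec_def)
qed

section \<open>Comparison of the iterations\<close>

context
  fixes Q :: "('m::topological_space \<Rightarrow> real \<Rightarrow> real ^ 'n) \<Rightarrow> ('m \<Rightarrow> real \<Rightarrow> real ^ 'n)"
  assumes Q: "Q \<in> C_plus \<rightarrow> C_plus"
    and A1: "A1 Q" and A2: "A2 Q" and A3: "A3 Q"
begin

lemma Q_iter_in_C_plus: "\<phi> \<in> C_plus \<Longrightarrow> (Q ^^ n) \<phi> \<in> C_plus"
  using Q by (induction n) auto

text \<open>
  Monotonicity on the order intervals below constant vectors is monotonicity on all of \<open>C_plus\<close>,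
  since these intervals exhaust it.
\<close>

lemma Q_mono:
  assumes "\<phi> \<in> C_plus" "\<psi> \<in> C_plus" "\<phi> \<le> \<psi>"
  shows "Q \<phi> \<le> Q \<psi>"
proof -
  obtain B where B: "\<And>\<theta> x. norm (\<psi> \<theta> x) \<le> B"
    using assms(2) C_space_norm_bound by (auto simp: C_plus_iff)
  define r :: "real ^ 'n" where "r = (\<chi> i. \<bar>B\<bar> + 1)"
  have r: "r \<in> interior orthant"
    by (simp add: interior_orthant r_def)
  have "\<psi> \<theta> x \<le> r" for \<theta> x
    unfolding less_eq_vec_def r_def
  proof
    fix i
    show "\<psi> \<theta> x $ i \<le> (\<chi> i. \<bar>B\<bar> + 1) $ i"
      using component_le_norm_cart[of "\<psi> \<theta> x" i] B[of \<theta> x] by simp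
  qed
  then have "\<psi> \<in> C_int (const_fun r)"
    using assms(2) by (auto simp: C_int_def C_plus_iff const_fun_def le_fun_def)
  moreover from this have "\<phi> \<in> C_int (const_fun r)"
    using assms order_trans[OF assms(3)] by (auto simp: C_int_def C_plus_iff le_funI)
  ultimately show ?thesis
    using A2 r assms(3) unfolding A2_def by blast
qed

lemma Q_iter_mono:
  assumes "\<phi> \<in> C_plus" "\<psi> \<in> C_plus" "\<phi> \<le> \<psi>"
  shows "(Q ^^ n) \<phi> \<le> (Q ^^ n) \<psi>"
  by (induction n) (auto intro!: assms Q_mono Q_iter_in_C_plus)

lemma Q_plus_iter_in_C_plus:
  assumes "\<phi> \<in> C_plus"
  shows "(Q_plus Q ^^ n) \<phi> \<in> C_plus"
proof -
  let ?f = "\<lambda>y. transl (- y) ((Q ^^ n) (transl y \<phi>))"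
  have lim: "limitin top_C ?f ((Q_plus Q ^^ n) \<phi>) at_top"
    using A3 assms by (auto simp: A3_def)
  have f: "?f y \<in> C_plus" for y
    by (intro transl_in_C_plus Q_iter_in_C_plus assms)
  have "0 \<le> (Q_plus Q ^^ n) \<phi> \<theta> x" for \<theta> x
    using f by (intro tendsto_lowerbound_vec[OF limitin_top_C_pointwise[OF lim]])
      (auto simp: C_plus_iff)
  moreover have "(Q_plus Q ^^ n) \<phi> \<in> C_space"
    using lim Metric_space.limitin_metric[OF Metric_space_C] by (auto simp: top_C_def)
  ultimately show ?thesis
    by (simp add: C_plus_iff)
qed

text \<open>
  \<open>Q \<phi>\<close> is the member \<open>y = 0\<close> of a family that increases to \<open>Q_plus Q \<phi>\<close>.
\<close>

lemma Q_le_Q_plus: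
  assumes \<phi>: "\<phi> \<in> C_plus"
  shows "Q \<phi> \<le> Q_plus Q \<phi>"
proof (intro le_funI)
  fix \<theta> x
  let ?f = "\<lambda>y. transl (- y) (Q (transl y \<phi>))"
  have "limitin top_C (\<lambda>y. transl (- y) ((Q ^^ 1) (transl y \<phi>))) ((Q_plus Q ^^ 1) \<phi>) at_top"
    using A3 \<phi> unfolding A3_def by blast
  then have lim: "limitin top_C ?f (Q_plus Q \<phi>) at_top"
    by simp
  have "Q \<phi> \<theta> x \<le> ?f y \<theta> x" if "y \<ge> 0" for y
  proof -
    have "Q (transl (- y) (transl y \<phi>)) \<le> ?f y"
      using A1 that transl_in_C_plus[OF \<phi>, of y] unfolding A1_def by blast
    moreover have "transl (- y) (transl y \<phi>) = \<phi>"
      by (simp add: transl_def)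
    ultimately show ?thesis
      by (simp add: le_fun_def)
  qed
  then have "\<forall>\<^sub>F y in at_top. Q \<phi> \<theta> x \<le> ?f y \<theta> x"
    by (intro eventually_mono[OF eventually_ge_at_top[of "0::real"]])
  then show "Q \<phi> \<theta> x \<le> Q_plus Q \<phi> \<theta> x"
    by (rule tendsto_lowerbound_vec[OF limitin_top_C_pointwise[OF lim]]) simp
qed

lemma Q_iter_le_Q_plus_iter:
  assumes "\<phi> \<in> C_plus"
  shows "(Q ^^ n) \<phi> \<le> (Q_plus Q ^^ n) \<phi>"
proof (induction n)
  case (Suc n)
  have "(Q ^^ Suc n) \<phi> \<le> Q ((Q_plus Q ^^ n) \<phi>)"
    using Suc by (auto intro!: Q_mono Q_iter_in_C_plus Q_plus_iter_in_C_plus assms)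
  also have "\<dots> \<le> (Q_plus Q ^^ Suc n) \<phi>"
    using Q_le_Q_plus[OF Q_plus_iter_in_C_plus[OF assms]] by simp
  finally show ?case .
qed simp

section \<open>Orbits of upper solutions\<close>

text \<open>
  A function is nondecreasing in \<open>x\<close> exactly if it lies below all its translates to the left,
  and \<open>A1\<close> pushes this relation through \<open>Q\<close>.
\<close>

lemma Q_iter_mono_space:
  assumes \<phi>: "\<phi> \<in> C_plus" and le: "\<And>y. y \<ge> 0 \<Longrightarrow> \<phi> \<le> transl (- y) \<phi>" and "x \<le> z"
  shows "(Q ^^ n) \<phi> \<theta> x \<le> (Q ^^ n) \<phi> \<theta> z"
proof -
  have "(Q ^^ n) \<phi> \<le> transl (- y) ((Q ^^ n) \<phi>)" if y: "y \<ge> 0" for y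
  proof (induction n)
    case 0
    show ?case using le[OF y] by simp
  next
    case (Suc n)
    have "(Q ^^ Suc n) \<phi> \<le> Q (transl (- y) ((Q ^^ n) \<phi>))"
      using Suc by (auto intro!: Q_mono transl_in_C_plus Q_iter_in_C_plus \<phi>)
    also have "\<dots> \<le> transl (- y) ((Q ^^ Suc n) \<phi>)"
      using A1 y Q_iter_in_C_plus[OF \<phi>, of n] by (simp add: A1_def)
    finally show ?case .
  qed
  from this[of "z - x"] have "(Q ^^ n) \<phi> \<le> transl (- (z - x)) ((Q ^^ n) \<phi>)"
    using \<open>x \<le> z\<close> by simp
  then have "(Q ^^ n) \<phi> \<theta> x \<le> transl (- (z - x)) ((Q ^^ n) \<phi>) \<theta> x"
    unfolding le_fun_def by blast
  then show ?thesis
    by (simp add: transl_def)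
qed

lemma Q_iter_decreasing:
  assumes \<phi>: "\<phi> \<in> C_plus" and le: "Q \<phi> \<le> \<phi>" and "k \<le> n"
  shows "(Q ^^ n) \<phi> \<le> (Q ^^ k) \<phi>"
proof -
  have "(Q ^^ Suc j) \<phi> \<le> (Q ^^ j) \<phi>" for j
    using Q_iter_mono[OF _ \<phi> le, of j] Q \<phi> by (auto simp: funpow_swap1)
  then show ?thesis
    using \<open>k \<le> n\<close> by (rule lift_Suc_antimono_le)
qed

text \<open>
  The value of the orbit far to the left is close to the orbit of the limit map at \<open>-\<infinity>\<close>. Reading
  the translates at \<open>x = 0\<close> suffices, because the orbit is monotone in \<open>x\<close>.
\<close>

lemma Q_iter_upper_solution_small:
  assumes UAA: "UAA (Q_minus Q)"
    and \<rho>: "\<rho> \<in> C_plus" and const: "\<And>y. transl y \<rho> = \<rho>" and e: "e > 0"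
  obtains k L where "\<And>\<theta>. norm ((Q ^^ k) \<rho> \<theta> (- L)) < e"
proof -
  have "(\<lambda>n. SUP (\<theta>, x)\<in>UNIV. (Q_minus Q ^^ n) \<rho> \<theta> x) \<longlonglongrightarrow> 0"
    using UAA \<rho> by (simp add: UAA_def)
  then obtain k where k: "norm (SUP (\<theta>, x)\<in>UNIV. (Q_minus Q ^^ k) \<rho> \<theta> x) < e / 2"
    using e by (fastforce simp: LIMSEQ_iff dest: spec[of _ "e / 2"])
  let ?m = "(Q_minus Q ^^ k) \<rho>" and ?f = "\<lambda>y. transl (- y) ((Q ^^ k) \<rho>)"
  have "limitin top_C (\<lambda>y. transl (- y) ((Q ^^ k) (transl y \<rho>))) ?m at_bot"
    using A3 \<rho> by (auto simp: A3_def)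
  then have lim: "limitin top_C ?f ?m at_bot"
    by (simp add: const)
  have "?m \<in> C_space"
    using lim Metric_space.limitin_metric[OF Metric_space_C] by (auto simp: top_C_def)
  then obtain B where B: "\<And>\<theta> x. norm (?m \<theta> x) \<le> B"
    using C_space_norm_bound by blast
  have m_le: "?m \<theta> x \<le> (\<chi> i. B)" for \<theta> x
    using component_le_norm_cart[of "?m \<theta> x"] B[of \<theta> x]
    by (auto simp: less_eq_vec_def intro: order_trans[OF abs_ge_self] order_trans)
  have m_nonneg: "0 \<le> ?m \<theta> x" for \<theta> x
    using transl_in_C_plus[OF Q_iter_in_C_plus[OF \<rho>, of k]]
    by (intro tendsto_lowerbound_vec[OF limitin_top_C_pointwise[OF lim]])
      (auto simp: C_plus_iff)
  have "bdd_above (range (\<lambda>(\<theta>, x). ?m \<theta> x))"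
    using m_le by (auto intro!: bdd_aboveI)
  then have "?m \<theta> 0 \<le> (SUP (\<theta>, x)\<in>UNIV. ?m \<theta> x)" for \<theta>
    using cSUP_upper[of "(\<theta>, 0)" UNIV "\<lambda>(\<theta>, x). ?m \<theta> x"] by simp
  then have m_small: "norm (?m \<theta> 0) < e / 2" for \<theta>
    using k norm_mono_vec[OF m_nonneg, of \<theta> 0] by (meson le_less_trans)
  have "\<forall>\<^sub>F y in at_bot. \<forall>\<theta>. norm (?f y \<theta> 0 - ?m \<theta> 0) < e / 2"
    using e by (intro limitin_top_C_uniform[OF lim]) simp
  then obtain y where y: "\<And>\<theta>. norm (?f y \<theta> 0 - ?m \<theta> 0) < e / 2"
    by (auto simp: eventually_at_bot_linorder)
  show thesis
  proof (rule that)
    fix \<theta>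
    show "norm ((Q ^^ k) \<rho> \<theta> (- (- y))) < e"
      using norm_triangle_ineq2[of "?f y \<theta> 0" "?m \<theta> 0"] y[of \<theta>] m_small[of \<theta>]
      by (simp add: transl_def)
  qed
qed

text \<open>
  An orbit started below an upper solution stays below that solution's orbit, whose value at \<open>- L\<close> and time
  \<open>k\<close> controls the whole quadrant \<open>n \<ge> k\<close>, \<open>x \<le> - L\<close>.
\<close>

lemma Q_iter_vanishes_left:
  assumes UAA: "UAA (Q_minus Q)"
    and \<rho>: "lift_Y \<beta> \<in> C_plus" and upper: "Q (lift_Y \<beta>) \<le> lift_Y \<beta>"
    and \<phi>: "\<phi> \<in> C_int (lift_Y \<beta>)" and \<epsilon>: "\<epsilon> > 0"
  shows "(\<lambda>n. SUP x\<in>{..- (real n * \<epsilon>)}. norm_Y (\<lambda>\<theta>. (Q ^^ n) \<phi> \<theta> x)) \<longlonglongrightarrow> 0"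
proof (rule LIMSEQ_I)
  fix e :: real
  assume e: "0 < e"
  have const: "transl y (lift_Y \<beta>) = lift_Y \<beta>" for y
    by (simp add: transl_def lift_Y_def)
  obtain k L where kL: "\<And>\<theta>. norm ((Q ^^ k) (lift_Y \<beta>) \<theta> (- L)) < e / 2"
    using Q_iter_upper_solution_small[OF UAA \<rho> const, of "e / 2"] e by auto
  obtain j where j: "L / \<epsilon> \<le> real j"
    using real_arch_simple by blast
  have \<phi>': "\<phi> \<in> C_plus" "\<phi> \<le> lift_Y \<beta>"
    using \<phi> C_int_subset_C_plus by (auto simp: C_int_def)
  have small: "norm ((Q ^^ n) \<phi> \<theta> x) \<le> e / 2"
    if n: "k \<le> n" "j \<le> n" and x: "x \<le> - (real n * \<epsilon>)" for n \<theta> x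
  proof -
    have "L \<le> real j * \<epsilon>"
      using j \<epsilon> by (simp add: field_simps)
    also have "\<dots> \<le> real n * \<epsilon>"
      using n \<epsilon> by (intro mult_right_mono) auto
    finally have xL: "x \<le> - L"
      using x by simp
    have "(Q ^^ n) \<phi> \<theta> x \<le> (Q ^^ n) (lift_Y \<beta>) \<theta> x"
      using Q_iter_mono[OF \<phi>'(1) \<rho> \<phi>'(2)] by (simp add: le_fun_def)
    also have "\<dots> \<le> (Q ^^ k) (lift_Y \<beta>) \<theta> x"
      using Q_iter_decreasing[OF \<rho> upper n(1)] by (simp add: le_fun_def)
    also have "\<dots> \<le> (Q ^^ k) (lift_Y \<beta>) \<theta> (- L)"
      by (rule Q_iter_mono_space[OF \<rho> _ xL]) (simp add: const)
    finally have "(Q ^^ n) \<phi> \<theta> x \<le> (Q ^^ k) (lift_Y \<beta>) \<theta> (- L)" .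
    moreover have "0 \<le> (Q ^^ n) \<phi> \<theta> x"
      using Q_iter_in_C_plus[OF \<phi>'(1)] by (simp add: C_plus_iff)
    ultimately show ?thesis
      using norm_mono_vec kL[of \<theta>] by (meson less_imp_le order_trans)
  qed
  have "norm ((SUP x\<in>{..- (real n * \<epsilon>)}. norm_Y (\<lambda>\<theta>. (Q ^^ n) \<phi> \<theta> x)) - 0) < e"
    if n: "n \<ge> max k j" for n
  proof -
    have le: "norm_Y (\<lambda>\<theta>. (Q ^^ n) \<phi> \<theta> x) \<le> e / 2" if "x \<le> - (real n * \<epsilon>)" for x
      unfolding norm_Y_def using small[OF _ _ that] n by (intro cSUP_least) auto
    have ge: "0 \<le> norm_Y (\<lambda>\<theta>. (Q ^^ n) \<phi> \<theta> x)" if "x \<le> - (real n * \<epsilon>)" for x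
    proof -
      have "bdd_above (range (\<lambda>\<theta>. norm ((Q ^^ n) \<phi> \<theta> x)))"
        using small[OF _ _ that] n by (intro bdd_aboveI[of _ "e / 2"]) auto
      then show ?thesis
        unfolding norm_Y_def by (rule cSUP_upper2) auto
    qed
    have "(SUP x\<in>{..- (real n * \<epsilon>)}. norm_Y (\<lambda>\<theta>. (Q ^^ n) \<phi> \<theta> x)) \<le> e / 2"
      using le by (intro cSUP_least) auto
    moreover have "bdd_above ((\<lambda>x. norm_Y (\<lambda>\<theta>. (Q ^^ n) \<phi> \<theta> x)) ` {..- (real n * \<epsilon>)})"
      using le by (intro bdd_aboveI[of _ "e / 2"]) auto
    then have "0 \<le> (SUP x\<in>{..- (real n * \<epsilon>)}. norm_Y (\<lambda>\<theta>. (Q ^^ n) \<phi> \<theta> x))"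
      by (rule cSUP_upper2[where x = "- (real n * \<epsilon>)"]) (auto intro: ge)
    ultimately show ?thesis
      using e by simp
  qed
  then show "\<exists>no. \<forall>n\<ge>no.
      norm ((SUP x\<in>{..- (real n * \<epsilon>)}. norm_Y (\<lambda>\<theta>. (Q ^^ n) \<phi> \<theta> x)) - 0) < e"
    by blast
qed

section \<open>Annihilation outside the spreading cone\<close>

lemma scaled_Compl_subset:
  fixes c :: real
  assumes "c \<noteq> 0"
  shows "(*) c ` (- A) \<subseteq> - ((*) c ` A)"
  using assms by auto

lemma norm_le_SUP_norm_Y:
  assumes "\<phi> \<in> C_space" "x \<in> S"
  shows "norm (\<phi> \<theta> x) \<le> (SUP x\<in>S. norm_Y (\<lambda>\<theta>. \<phi> \<theta> x))"
proof -
  obtain B where B: "\<And>\<theta> x. norm (\<phi> \<theta> x) \<le> B"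
    using assms(1) C_space_norm_bound by blast
  have "norm (\<phi> \<theta> x) \<le> norm_Y (\<lambda>\<theta>. \<phi> \<theta> x)"
    unfolding norm_Y_def using B by (intro cSUP_upper bdd_aboveI[of _ B]) auto
  also have "bdd_above ((\<lambda>x. norm_Y (\<lambda>\<theta>. \<phi> \<theta> x)) ` S)"
    using B by (auto intro!: bdd_aboveI[of _ B] cSUP_least simp: norm_Y_def)
  then have "norm_Y (\<lambda>\<theta>. \<phi> \<theta> x) \<le> (SUP x\<in>S. norm_Y (\<lambda>\<theta>. \<phi> \<theta> x))"
    using assms(2) by (intro cSUP_upper)
  finally show ?thesis .
qed

lemma Q_iter_vanishes_outside_cone:
  assumes AA: "AA (Q_plus Q) \<beta> cminus cplus"
    and \<phi>: "\<phi> \<in> C_int (lift_Y \<beta>)" "compact_support \<phi>" and \<epsilon>: "\<epsilon> > 0"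
  shows "(\<lambda>n. SUP (\<theta>, x)\<in>UNIV \<times> ((*) (real n) ` (- {- cminus - \<epsilon>..cplus + \<epsilon>})).
            (Q ^^ n) \<phi> \<theta> x) \<longlonglongrightarrow> 0"
proof -
  let ?I = "{- cminus - \<epsilon>..cplus + \<epsilon>}"
  let ?u = "\<lambda>n. SUP (\<theta>, x)\<in>UNIV \<times> ((*) (real n) ` (- ?I)). (Q ^^ n) \<phi> \<theta> x"
  let ?s = "\<lambda>n. SUP x\<in>- ((*) (real n) ` ?I). norm_Y (\<lambda>\<theta>. (Q_plus Q ^^ n) \<phi> \<theta> x)"
  have s: "?s \<longlonglongrightarrow> 0"
    using AA \<phi> \<epsilon> by (simp add: AA_def)
  have \<phi>': "\<phi> \<in> C_plus"
    using \<phi> C_int_subset_C_plus by auto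
  have nonneg: "0 \<le> (Q ^^ n) \<phi> \<theta> x" for n \<theta> x
    using Q_iter_in_C_plus[OF \<phi>'] by (simp add: C_plus_iff)
  have bounds: "0 \<le> ?u n $ i \<and> ?u n $ i \<le> ?s n" if n: "n \<ge> 1" for n i
  proof -
    have le: "(Q ^^ n) \<phi> \<theta> x \<le> (\<chi> i. ?s n)" if x: "x \<in> (*) (real n) ` (- ?I)" for \<theta> x
      unfolding less_eq_vec_def
    proof
      fix i
      have "x \<in> - ((*) (real n) ` ?I)"
        using x scaled_Compl_subset[of "real n" ?I] n by auto
      then have "norm ((Q_plus Q ^^ n) \<phi> \<theta> x) \<le> ?s n"
        using Q_plus_iter_in_C_plus[OF \<phi>', of n]
        by (intro norm_le_SUP_norm_Y) (auto simp: C_plus_iff)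
      moreover have "(Q ^^ n) \<phi> \<theta> x $ i \<le> (Q_plus Q ^^ n) \<phi> \<theta> x $ i"
        using Q_iter_le_Q_plus_iter[OF \<phi>', of n] by (auto simp: le_fun_def less_eq_vec_def)
      ultimately show "(Q ^^ n) \<phi> \<theta> x $ i \<le> (\<chi> i. ?s n) $ i"
        using component_le_norm_cart[of "(Q_plus Q ^^ n) \<phi> \<theta> x" i] by simp
    qed
    have x0: "real n * (cplus + \<epsilon> + 1) \<in> (*) (real n) ` (- ?I)"
      by auto
    have "?u n \<le> (\<chi> i. ?s n)"
      using x0 le by (intro cSUP_least) auto
    moreover have "bdd_above ((\<lambda>(\<theta>, x). (Q ^^ n) \<phi> \<theta> x) ` (UNIV \<times> ((*) (real n) ` (- ?I))))"
      using le by (intro bdd_aboveI[of _ "\<chi> i. ?s n"]) auto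
    then have "0 \<le> ?u n"
      using x0 nonneg
      by (intro cSUP_upper2[where x = "(undefined, real n * (cplus + \<epsilon> + 1))"]) auto
    ultimately show ?thesis
      by (simp add: less_eq_vec_def)
  qed
  show ?thesis
  proof (rule vec_tendstoI)
    fix i
    \<comment> \<open>At \<open>n = 0\<close> the scaled complement is \<open>{0}\<close>, which misses the complement of the scaled
      interval, so \<open>bounds\<close> starts at \<open>n = 1\<close>.\<close>
    have "\<forall>\<^sub>F n in sequentially. 0 \<le> ?u n $ i \<and> ?u n $ i \<le> ?s n"
      by (intro eventually_mono[OF eventually_ge_at_top[of 1]] bounds)
    then have "(\<lambda>n. ?u n $ i) \<longlonglongrightarrow> 0"
      unfolding eventually_conj_iff by (intro tendsto_sandwich[OF _ _ tendsto_const s]) blast+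
    then show "(\<lambda>n. ?u n $ i) \<longlonglongrightarrow> 0 $ i"
      by simp
  qed
qed

end

section \<open>Spreading bounds for the original iteration\<close>

theorem theorem3p2:
  fixes Q :: "('m::topological_space \<Rightarrow> real \<Rightarrow> real ^ 'n) \<Rightarrow> ('m \<Rightarrow> real \<Rightarrow> real ^ 'n)"
    and rstar :: "'m \<Rightarrow> real ^ 'n"
    and cminus cplus :: real
  assumes M: "compact (UNIV :: 'm set)"
    and Q: "Q \<in> C_plus \<rightarrow> C_plus"
    and A1: "A1 Q" and A2: "A2 Q" and A3: "A3 Q" and A4: "A4 Q rstar"
    and AA: "AA (Q_plus Q) rstar cminus cplus"
    and UAA: "UAA (Q_minus Q)"
  shows "(\<forall>\<phi>\<in>C_int (lift_Y rstar). compact_support \<phi> \<longrightarrow>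
            (\<forall>\<epsilon>>0. (\<lambda>n. SUP (\<theta>, x)\<in>UNIV \<times> ((*) (real n) ` (- {- cminus - \<epsilon>..cplus + \<epsilon>})).
                       (Q ^^ n) \<phi> \<theta> x) \<longlonglongrightarrow> 0))
       \<and> (\<forall>rss\<in>Int_Y_plus. Q (lift_Y rss) \<le> lift_Y rss \<longrightarrow>
            (\<forall>\<epsilon>>0. \<forall>\<phi>\<in>C_int (lift_Y rss).
               (\<lambda>n. SUP x\<in>{..- (real n * \<epsilon>)}. norm_Y (\<lambda>\<theta>. (Q ^^ n) \<phi> \<theta> x)) \<longlonglongrightarrow> 0))
       \<and> (\<forall>\<epsilon>>0. \<forall>\<phi>\<in>C_int (lift_Y rstar).
            (\<lambda>n. SUP x\<in>{..- (real n * \<epsilon>)}. norm_Y (\<lambda>\<theta>. (Q ^^ n) \<phi> \<theta> x)) \<longlonglongrightarrow> 0)"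
proof (intro conjI ballI allI impI)
  fix \<phi> and \<epsilon> :: real
  assume "\<phi> \<in> C_int (lift_Y rstar)" "compact_support \<phi>" "\<epsilon> > 0"
  then show "(\<lambda>n. SUP (\<theta>, x)\<in>UNIV \<times> ((*) (real n) ` (- {- cminus - \<epsilon>..cplus + \<epsilon>})).
      (Q ^^ n) \<phi> \<theta> x) \<longlonglongrightarrow> 0"
    by (rule Q_iter_vanishes_outside_cone[OF Q A1 A2 A3 AA])
next
  fix rss :: "'m \<Rightarrow> real ^ 'n" and \<epsilon> :: real and \<phi>
  assume "rss \<in> Int_Y_plus" "Q (lift_Y rss) \<le> lift_Y rss" "\<epsilon> > 0" "\<phi> \<in> C_int (lift_Y rss)"
  then show "(\<lambda>n. SUP x\<in>{..- (real n * \<epsilon>)}. norm_Y (\<lambda>\<theta>. (Q ^^ n) \<phi> \<theta> x)) \<longlonglongrightarrow> 0"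
    using Q_iter_vanishes_left[OF Q A1 A2 A3 UAA] lift_Y_in_C_plus[OF M] by blast
next
  fix \<epsilon> :: real and \<phi>
  assume "\<epsilon> > 0" "\<phi> \<in> C_int (lift_Y rstar)"
  moreover have rs: "lift_Y rstar \<in> C_plus"
    by (rule lift_Y_in_C_plus[OF M]) (use A4 in \<open>simp add: A4_def\<close>)
  moreover have "Q (lift_Y rstar) \<le> lift_Y rstar"
    using Q_le_Q_plus[OF Q A1 A2 A3 rs] A4 by (simp add: A4_def)
  ultimately show "(\<lambda>n. SUP x\<in>{..- (real n * \<epsilon>)}. norm_Y (\<lambda>\<theta>. (Q ^^ n) \<phi> \<theta> x)) \<longlonglongrightarrow> 0"
    using Q_iter_vanishes_left[OF Q A1 A2 A3 UAA] by blast
qed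

end
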